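(* Let $K\in\mathbb{N}$ and suppose that under $M_K$ the parameters $\lambda_1,\ldots,\lambda_K$ are a priori independent and each $\lambda_i$ follows an inverse gamma distribution with shape parameter $a_i^{(K)}>0$ and scale parameter $b_i^{(K)}>0$, i.e. $\pi_{\underline{\lambda_i}}(\lambda_i|M_K)=f_{IG}(\lambda_i|a_i^{(K)},b_i^{(K)})$. Then the coherent prior for $\lambda_1$ under $M_1$ is the inverse gamma distribution with shape parameter $a^{(1)}$ and scale parameter $b^{(1)}$, $\pi_{\underline{\lambda_1}}(\lambda_1|M_1)=f_{IG}(\lambda_1|a^{(1)},b^{(1)})$, where $$a^{(1)}=\sum_{i=1}^{K}a_i^{(K)}+K-1,\qquad b^{(1)}=\left(\sum_{i=1}^{K}\frac{1}{b_i^{(K)}}\right)^{-1}.$$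
   Context: For $a,b>0$ the inverse gamma density is $f_{IG}(x|a,b)=\frac{1}{b^{a}\Gamma(a)}x^{-(a+1)}\exp\{-\frac{1}{bx}\}$ for $x>0$ (and $0$ for $x\le 0$). $M_K$ is a $K$-component (mixture or Markov-switching) model containing a group of scalar mixture parameters $\lambda_1,\ldots,\lambda_K$, a priori independent of each other (and of all other parameters) with densities $\pi_{\underline{\lambda_i}}(\cdot|M_K)$. $M_1$ is the nested single-component model, with a single scalar parameter $\lambda_1$ in place of this group, obtained from $M_K$ under $\lambda_1=\ldots=\lambda_K$. Let $\tau_i=\lambda_i-\lambda_1$ ($i=2,\ldots,K$), $\tau=(\tau_2,\ldots,\tau_K)'$ (empty if $K=1$), and let $p(x,t)=p_\lambda(x,t_2+x,\ldots,t_K+x)$ be the joint prior density of $(\lambda_1,\tau)$ under $M_K$, with $p_\lambda$ the joint density of $(\lambda_1,\ldots,\lambda_K)$, evaluated pointwise. The coherent prior for $\lambda_1$ under $M_1$ is the conditional prior of $\lambda_1$ given $\tau=0$ under $M_K$, i.e. the distribution with density $x\mapsto p(x,0)/\int_{\mathbb{R}}p(u,0)\,du$. *)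

theory Defs
  imports "HOL-Probability.Probability"
begin

text \<open>
  The scale parameter \<open>b\<close> enters inversely: \<open>X\<close> has this density iff
  \<open>1 / X\<close> has a gamma density with shape \<open>a\<close> and scale \<open>b\<close>.
\<close>

definition inverse_gamma_density :: "real \<Rightarrow> real \<Rightarrow> real \<Rightarrow> real" where
  "inverse_gamma_density a b x =
     (if x \<le> 0 then 0
      else 1 / (b powr a * Gamma a) * x powr (- (a + 1)) * exp (- (1 / (b * x))))"

text \<open>
  The conditional distribution of \<open>X\<close> given the null event \<open>T = t\<close> depends on the chosen version
  \<open>p\<close> of the joint density of \<open>(X, T)\<close>, so the version is an explicit argument. The reference
  measure for the values of \<open>T\<close> is \<open>N\<close>, and \<open>q\<close> is the density of the conditional distribution.
\<close>

definition has_conditional_density ::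
  "'w measure \<Rightarrow> ('w \<Rightarrow> real) \<Rightarrow> 't measure \<Rightarrow> ('w \<Rightarrow> 't) \<Rightarrow> (real \<Rightarrow> 't \<Rightarrow> real) \<Rightarrow> 't
     \<Rightarrow> (real \<Rightarrow> real) \<Rightarrow> bool" where
  "has_conditional_density M X N T p t q \<longleftrightarrow>
     distributed M (lborel \<Otimes>\<^sub>M N) (\<lambda>\<omega>. (X \<omega>, T \<omega>)) (\<lambda>(x, s). ennreal (p x s)) \<and>
     integrable lborel (\<lambda>u. p u t) \<and>
     0 < (\<integral>u. p u t \<partial>lborel) \<and>
     (\<forall>x. q x = p x t / (\<integral>u. p u t \<partial>lborel))"

text \<open>
  Vectors indexed by \<open>1, \<dots>, K\<close> are extensional functions on \<open>{1..K}\<close>; the vector of differences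
  lives on \<open>{2..K}\<close> and is the empty vector for \<open>K = 1\<close>.
\<close>

definition param_vector :: "nat \<Rightarrow> (nat \<Rightarrow> 'w \<Rightarrow> real) \<Rightarrow> 'w \<Rightarrow> nat \<Rightarrow> real" where
  "param_vector K lam \<omega> = (\<lambda>i\<in>{1..K}. lam i \<omega>)"

definition param_differences :: "nat \<Rightarrow> (nat \<Rightarrow> 'w \<Rightarrow> real) \<Rightarrow> 'w \<Rightarrow> nat \<Rightarrow> real" where
  "param_differences K lam \<omega> = (\<lambda>i\<in>{2..K}. lam i \<omega> - lam 1 \<omega>)"

definition product_density :: "nat \<Rightarrow> (nat \<Rightarrow> real \<Rightarrow> real) \<Rightarrow> (nat \<Rightarrow> real) \<Rightarrow> real" where
  "product_density K \<pi> v = (\<Prod>i\<in>{1..K}. \<pi> i (v i))"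

text \<open>
  The map from \<open>(\<lambda>\<^sub>1, \<tau>)\<close> back to \<open>(\<lambda>\<^sub>1, \<dots>, \<lambda>\<^sub>K)\<close> has Jacobian determinant 1.
\<close>

definition reparam_density :: "nat \<Rightarrow> ((nat \<Rightarrow> real) \<Rightarrow> real) \<Rightarrow> real \<Rightarrow> (nat \<Rightarrow> real) \<Rightarrow> real" where
  "reparam_density K f x t = f (\<lambda>i\<in>{1..K}. if i = 1 then x else t i + x)"

text \<open>
  \<open>M\<close> carries the prior of the \<open>K\<close>-component model, \<open>f\<close> is the version of the joint prior
  density of the component parameters that is evaluated pointwise, and \<open>q\<close> is the coherent prior
  density in the single-component model.
\<close>

definition has_coherent_prior_density ::
  "'w measure \<Rightarrow> nat \<Rightarrow> (nat \<Rightarrow> 'w \<Rightarrow> real) \<Rightarrow> ((nat \<Rightarrow> real) \<Rightarrow> real) \<Rightarrow> (real \<Rightarrow> real) \<Rightarrow> bool" where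
  "has_coherent_prior_density M K lam f q \<longleftrightarrow>
     distributed M (\<Pi>\<^sub>M i\<in>{1..K}. lborel) (param_vector K lam) (\<lambda>v. ennreal (f v)) \<and>
     has_conditional_density M (lam 1) (\<Pi>\<^sub>M i\<in>{2..K}. lborel) (param_differences K lam)
       (reparam_density K f) (\<lambda>i\<in>{2..K}. 0) q"

end

theory Submission
  imports Defs
begin

text \<open>
  On the line \<open>\<tau> = 0\<close> all components of the parameter vector coincide, so the joint density of
  \<open>(\<lambda>\<^sub>1, \<tau>)\<close> restricted to that line is the pointwise product of the \<open>K\<close> inverse gamma densities.
  Up to a constant each factor is \<open>x powr - (a\<^sub>i + 1) * exp (- 1 / (b\<^sub>i * x))\<close>, a family that is closed
  under multiplication: the exponents \<open>a\<^sub>i + 1\<close> and the rates \<open>1 / b\<^sub>i\<close> add up. Since the exponent of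
  the product must again be read as shape plus one, the shape is \<open>(\<Sum>i. (a\<^sub>i + 1)) - 1\<close>, which is where
  \<open>K - 1\<close> comes from (\<open>prod_inverse_gamma_density\<close>). An inverse gamma density integrates to one, by
  the substitution \<open>x = 1 / (b * t)\<close> in the Gamma integral
  (\<open>has_bochner_integral_inverse_gamma_density\<close>), so dividing by the integral over the line removes
  exactly the constant.

  What remains is measure theory: the pointwise formulas have to be densities of the random
  vectors. For \<open>(\<lambda>\<^sub>1, \<dots>, \<lambda>\<^sub>K)\<close> this is independence (\<open>indep_vars_imp_distributed_PiM\<close>). For
  \<open>(\<lambda>\<^sub>1, \<tau>)\<close> it is a change of variables that needs no differential calculus: the map
  \<open>(x, t) \<mapsto> (x, t\<^sub>2 + x, \<dots>, t\<^sub>K + x)\<close> translates each slice \<open>x = const\<close>, hence preserves Lebesgue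
  measure (\<open>distr_PiM_lborel_shear\<close>), and densities are transported along measure-preserving
  bijections by composition (\<open>distributed_inverse_image\<close>).
\<close>

section \<open>Densities of independent vectors\<close>

text \<open>
  Both sides give a box \<open>Pi\<^sub>E I A\<close> the product of the one-dimensional integrals over the \<open>A i\<close>, by
  Tonelli, and boxes determine a product measure.
\<close>

lemma PiM_density:
  fixes N :: "'i \<Rightarrow> 'a measure" and f :: "'i \<Rightarrow> 'a \<Rightarrow> ennreal"
  assumes "product_sigma_finite N" and fin: "finite I"
    and f: "\<And>i. i \<in> I \<Longrightarrow> f i \<in> borel_measurable (N i)"
    and sf: "\<And>i. i \<in> I \<Longrightarrow> sigma_finite_measure (density (N i) (f i))"
  shows "(\<Pi>\<^sub>M i\<in>I. density (N i) (f i)) = density (PiM I N) (\<lambda>v. \<Prod>i\<in>I. f i (v i))"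
proof -
  interpret N: product_sigma_finite N by fact
  \<comment> \<open>The uniqueness theorem for product measures wants sigma-finiteness at every index, so the
    densities are replaced by the original measures outside \<open>I\<close>.\<close>
  define N' where "N' = (\<lambda>i. if i \<in> I then density (N i) (f i) else N i)"
  interpret N': product_sigma_finite N'
    unfolding product_sigma_finite_def N'_def using sf N.sigma_finite_measures by auto
  have meas[measurable]: "(\<lambda>v. \<Prod>i\<in>I. f i (v i)) \<in> borel_measurable (PiM I N)"
    by (intro borel_measurable_prod_ennreal measurable_compose[OF measurable_component_singleton])
       (use f in auto)
  have "density (PiM I N) (\<lambda>v. \<Prod>i\<in>I. f i (v i)) = PiM I N'"
  proof (rule N'.PiM_eqI[OF fin])
    show "sets (density (PiM I N) (\<lambda>v. \<Prod>i\<in>I. f i (v i))) = sets (PiM I N')"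
      by (simp, intro sets_PiM_cong) (auto simp: N'_def)
  next
    fix A assume "\<And>i. i \<in> I \<Longrightarrow> A i \<in> sets (N' i)"
    then have A: "A i \<in> sets (N i)" if "i \<in> I" for i
      using that by (force simp: N'_def)
    have "emeasure (density (PiM I N) (\<lambda>v. \<Prod>i\<in>I. f i (v i))) (Pi\<^sub>E I A)
        = (\<integral>\<^sup>+ v. (\<Prod>i\<in>I. f i (v i)) * indicator (Pi\<^sub>E I A) v \<partial>PiM I N)"
      by (rule emeasure_density[OF meas]) (use fin A in \<open>auto intro: sets_PiM_I_finite\<close>)
    also have "\<dots> = (\<integral>\<^sup>+ v. (\<Prod>i\<in>I. f i (v i) * indicator (A i) (v i)) \<partial>PiM I N)"
    proof (rule nn_integral_cong)
      fix v assume v: "v \<in> space (PiM I N)"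
      have "indicator (Pi\<^sub>E I A) v = (\<Prod>i\<in>I. indicator (A i) (v i) :: ennreal)"
        using v fin by (auto simp: indicator_def space_PiM PiE_iff prod_zero_iff)
      then show "(\<Prod>i\<in>I. f i (v i)) * indicator (Pi\<^sub>E I A) v
          = (\<Prod>i\<in>I. f i (v i) * indicator (A i) (v i))"
        by (simp add: prod.distrib)
    qed
    also have "\<dots> = (\<Prod>i\<in>I. \<integral>\<^sup>+ x. f i x * indicator (A i) x \<partial>N i)"
      by (rule N.product_nn_integral_prod[OF fin]) (use f A in auto)
    also have "\<dots> = (\<Prod>i\<in>I. emeasure (N' i) (A i))"
      by (rule prod.cong) (auto simp: N'_def emeasure_density f A)
    finally show "emeasure (density (PiM I N) (\<lambda>v. \<Prod>i\<in>I. f i (v i))) (Pi\<^sub>E I A)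
        = (\<Prod>i\<in>I. emeasure (N' i) (A i))" .
  qed
  also have "\<dots> = (\<Pi>\<^sub>M i\<in>I. density (N i) (f i))"
    by (rule PiM_cong) (auto simp: N'_def)
  finally show ?thesis ..
qed

lemma (in prob_space) indep_vars_imp_distributed_PiM:
  fixes X :: "'i \<Rightarrow> 'a \<Rightarrow> real" and f :: "'i \<Rightarrow> real \<Rightarrow> ennreal"
  assumes fin: "finite I" and ne: "I \<noteq> {}"
    and indep: "indep_vars (\<lambda>_. borel) X I"
    and X: "\<And>i. i \<in> I \<Longrightarrow> distributed M lborel (X i) (f i)"
  shows "distributed M (\<Pi>\<^sub>M i\<in>I. lborel) (\<lambda>\<omega>. \<lambda>i\<in>I. X i \<omega>) (\<lambda>v. \<Prod>i\<in>I. f i (v i))"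
proof -
  have rv: "random_variable borel (X i)" if "i \<in> I" for i
    using distributed_measurable[OF X[OF that]] by simp
  have f: "f i \<in> borel_measurable lborel" if "i \<in> I" for i
    using distributed_borel_measurable[OF X[OF that]] .
  have d: "distr M borel (X i) = density lborel (f i)" if "i \<in> I" for i
    using distributed_distr_eq_density[OF X[OF that]] distr_cong[of M M lborel borel "X i" "X i"]
    by simp
  have sets: "sets (\<Pi>\<^sub>M i\<in>I. lborel :: real measure) = sets (\<Pi>\<^sub>M i\<in>I. borel)"
    by (rule sets_PiM_cong) auto
  have "distr M (\<Pi>\<^sub>M i\<in>I. lborel) (\<lambda>\<omega>. \<lambda>i\<in>I. X i \<omega>)
      = distr M (\<Pi>\<^sub>M i\<in>I. borel) (\<lambda>\<omega>. \<lambda>i\<in>I. X i \<omega>)"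
    by (rule distr_cong) (auto simp: sets)
  also have "\<dots> = (\<Pi>\<^sub>M i\<in>I. distr M borel (X i))"
    using indep_vars_iff_distr_eq_PiM'[OF ne, where X = X and M' = "\<lambda>_. borel"] rv indep by auto
  also have "\<dots> = (\<Pi>\<^sub>M i\<in>I. density lborel (f i))"
    by (rule PiM_cong) (auto simp: d)
  also have "\<dots> = density (\<Pi>\<^sub>M i\<in>I. lborel) (\<lambda>v. \<Prod>i\<in>I. f i (v i))"
  proof (rule PiM_density[OF _ fin f])
    show "product_sigma_finite (\<lambda>_::'i. lborel :: real measure)" by standard
    fix i assume "i \<in> I"
    then interpret Xi: prob_space "density lborel (f i)"
      using prob_space_distr[OF rv] d by metis
    show "sigma_finite_measure (density lborel (f i))" by unfold_locales
  qed
  finally show ?thesis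
    unfolding distributed_def
    using f rv
    by (auto intro!: borel_measurable_prod_ennreal measurable_restrict
        intro: measurable_compose[OF measurable_component_singleton])
qed

section \<open>Change of variables to the first component and the differences\<close>

text \<open>
  The law of \<open>X\<close> is the image under \<open>\<Phi>\<close> of the measure on \<open>N'\<close> with density \<open>f \<circ> \<Phi>\<close>, because
  \<open>\<Phi>\<close> preserves the reference measure; applying the left inverse \<open>\<Psi>\<close> undoes this image. The formula
  contains no Jacobian for the same reason.
\<close>

lemma distributed_inverse_image:
  assumes X: "distributed M N X f"
    and \<Phi>[measurable]: "\<Phi> \<in> measurable N' N" and pres: "distr N' N \<Phi> = N"
    and \<Psi>[measurable]: "\<Psi> \<in> measurable N N'"
    and inv: "\<And>z. z \<in> space N' \<Longrightarrow> \<Psi> (\<Phi> z) = z"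
  shows "distributed M N' (\<lambda>\<omega>. \<Psi> (X \<omega>)) (\<lambda>z. f (\<Phi> z))"
proof -
  have [measurable]: "X \<in> measurable M N" "f \<in> borel_measurable N"
    using X by (auto simp: distributed_def)
  have "distr M N' (\<lambda>\<omega>. \<Psi> (X \<omega>)) = distr (distr M N X) N' \<Psi>"
    by (simp add: distr_distr comp_def)
  also have "\<dots> = distr (density (distr N' N \<Phi>) f) N' \<Psi>"
    using X by (simp add: distributed_def pres)
  also have "\<dots> = density N' (\<lambda>z. f (\<Phi> z))"
    using distr_density_distr[OF \<Phi> \<Psi>, of f] inv by (simp add: comp_def)
  finally show ?thesis
    by (simp add: distributed_def)
qed

lemma distr_PiM_lborel_shift:
  fixes c :: "'i \<Rightarrow> real"
  assumes fin: "finite I"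
  shows "distr (\<Pi>\<^sub>M i\<in>I. lborel) (\<Pi>\<^sub>M i\<in>I. lborel) (\<lambda>t. \<lambda>i\<in>I. t i + c i) = (\<Pi>\<^sub>M i\<in>I. lborel)"
proof -
  interpret product_sigma_finite "\<lambda>_::'i. lborel :: real measure" by standard
  have m[measurable]: "(\<lambda>t. \<lambda>i\<in>I. t i + c i) \<in> measurable (\<Pi>\<^sub>M i\<in>I. lborel) (\<Pi>\<^sub>M i\<in>I. lborel)"
    by measurable
  show ?thesis
  proof (rule PiM_eqI[OF fin])
    fix A :: "'i \<Rightarrow> real set" assume A: "\<And>i. i \<in> I \<Longrightarrow> A i \<in> sets lborel"
    have A': "(\<lambda>x. x + c i) -` A i \<in> sets lborel" if "i \<in> I" for i
      using measurable_sets[of "\<lambda>x. x + c i" lborel lborel "A i"] A[OF that] by simp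
    have "emeasure (distr (\<Pi>\<^sub>M i\<in>I. lborel) (\<Pi>\<^sub>M i\<in>I. lborel) (\<lambda>t. \<lambda>i\<in>I. t i + c i)) (Pi\<^sub>E I A)
      = emeasure (\<Pi>\<^sub>M i\<in>I. lborel)
          ((\<lambda>t. \<lambda>i\<in>I. t i + c i) -` Pi\<^sub>E I A \<inter> space (\<Pi>\<^sub>M i\<in>I. lborel))"
      by (rule emeasure_distr[OF m]) (use fin A in \<open>auto intro: sets_PiM_I_finite\<close>)
    also have "(\<lambda>t. \<lambda>i\<in>I. t i + c i) -` Pi\<^sub>E I A \<inter> space (\<Pi>\<^sub>M i\<in>I. lborel)
      = Pi\<^sub>E I (\<lambda>i. (\<lambda>x. x + c i) -` A i)"
      by (auto simp: space_PiM PiE_iff)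
    also have "emeasure (\<Pi>\<^sub>M i\<in>I. lborel) \<dots> = (\<Prod>i\<in>I. emeasure lborel ((\<lambda>x. x + c i) -` A i))"
      by (rule emeasure_PiM[OF fin A'])
    also have "\<dots> = (\<Prod>i\<in>I. emeasure lborel (A i))"
    proof (rule prod.cong)
      fix i assume i: "i \<in> I"
      have "emeasure lborel (A i) = emeasure (distr lborel borel ((+) (c i))) (A i)"
        by (simp add: lborel_distr_plus)
      also have "\<dots> = emeasure lborel ((\<lambda>x. x + c i) -` A i)"
        using A[OF i] by (subst emeasure_distr) (auto simp: add.commute[of _ "c i"] vimage_def)
      finally show "emeasure lborel ((\<lambda>x. x + c i) -` A i) = emeasure lborel (A i)" ..
    qed simp
    finally show "emeasure (distr (\<Pi>\<^sub>M i\<in>I. lborel) (\<Pi>\<^sub>M i\<in>I. lborel) (\<lambda>t. \<lambda>i\<in>I. t i + c i)) (Pi\<^sub>E I A)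
      = (\<Prod>i\<in>I. emeasure lborel (A i))" .
  qed simp
qed

text \<open>
  For fixed \<open>x\<close> the map acts on the coordinates in \<open>J\<close> as a translation, which leaves the inner
  integral in Tonelli's theorem unchanged. This is the statement that the Jacobian determinant is 1.
\<close>

lemma distr_PiM_lborel_shear:
  assumes fin: "finite J" and k: "k \<notin> J"
  shows "distr (lborel \<Otimes>\<^sub>M (\<Pi>\<^sub>M i\<in>J. lborel)) (\<Pi>\<^sub>M i\<in>insert k J. lborel)
      (\<lambda>(x, t). \<lambda>i\<in>insert k J. if i = k then x else t i + x) = (\<Pi>\<^sub>M i\<in>insert k J. lborel :: real measure)"
    (is "distr ?P ?Q ?\<Phi> = ?Q")
proof (rule measure_eqI)
  interpret product_sigma_finite "\<lambda>_::'a. lborel :: real measure" by standard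
  interpret J: sigma_finite_measure "\<Pi>\<^sub>M i\<in>J. lborel :: real measure"
    by (rule sigma_finite[OF fin])
  have m[measurable]: "?\<Phi> \<in> measurable ?P ?Q"
    unfolding case_prod_beta
  proof (rule measurable_restrict)
    fix i assume "i \<in> insert k J"
    then show "(\<lambda>z. if i = k then fst z else snd z i + fst z) \<in> measurable ?P lborel"
      by (cases "i = k") auto
  qed
  fix A assume "A \<in> sets (distr ?P ?Q ?\<Phi>)"
  then have A[measurable]: "A \<in> sets ?Q" by simp
  have "emeasure (distr ?P ?Q ?\<Phi>) A = (\<integral>\<^sup>+ z. indicator A (?\<Phi> z) \<partial>?P)"
    using nn_integral_distr[OF m, of "indicator A"] by simp
  also have "\<dots> = (\<integral>\<^sup>+ x. \<integral>\<^sup>+ t. indicator A (?\<Phi> (x, t)) \<partial>(\<Pi>\<^sub>M i\<in>J. lborel) \<partial>lborel)"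
    by (rule J.nn_integral_fst[symmetric]) measurable
  also have "\<dots> = (\<integral>\<^sup>+ x. \<integral>\<^sup>+ t. indicator A (t(k := x)) \<partial>(\<Pi>\<^sub>M i\<in>J. lborel) \<partial>lborel)"
  proof (rule nn_integral_cong)
    fix x :: real
    have [measurable]: "(\<lambda>t. t(k := x)) \<in> measurable (\<Pi>\<^sub>M i\<in>J. lborel) ?Q"
      by (rule measurable_fun_upd[where J = J]) auto
    have eq: "?\<Phi> (x, t) = (\<lambda>i\<in>J. t i + x)(k := x)" for t
      using k by (auto simp: fun_eq_iff)
    have "(\<integral>\<^sup>+ t. indicator A (t(k := x)) \<partial>(\<Pi>\<^sub>M i\<in>J. lborel))
        = (\<integral>\<^sup>+ t. indicator A (t(k := x))
             \<partial>distr (\<Pi>\<^sub>M i\<in>J. lborel) (\<Pi>\<^sub>M i\<in>J. lborel) (\<lambda>t. \<lambda>i\<in>J. t i + x))"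
      by (simp only: distr_PiM_lborel_shift[OF fin])
    also have "\<dots> = (\<integral>\<^sup>+ t. indicator A ((\<lambda>i\<in>J. t i + x)(k := x)) \<partial>(\<Pi>\<^sub>M i\<in>J. lborel))"
      by (rule nn_integral_distr) measurable
    finally show "(\<integral>\<^sup>+ t. indicator A (?\<Phi> (x, t)) \<partial>(\<Pi>\<^sub>M i\<in>J. lborel))
        = (\<integral>\<^sup>+ t. indicator A (t(k := x)) \<partial>(\<Pi>\<^sub>M i\<in>J. lborel))"
      unfolding eq ..
  qed
  also have "\<dots> = (\<integral>\<^sup>+ v. indicator A v \<partial>?Q)"
    by (rule product_nn_integral_insert_rev[OF fin k, symmetric]) measurable
  also have "\<dots> = emeasure ?Q A"
    by simp
  finally show "emeasure (distr ?P ?Q ?\<Phi>) A = emeasure ?Q A" .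
qed simp

lemma distributed_reparam:
  assumes K: "1 \<le> K"
    and d: "distributed M (\<Pi>\<^sub>M i\<in>{1..K}. lborel) (param_vector K lam) (\<lambda>v. ennreal (f v))"
  shows "distributed M (lborel \<Otimes>\<^sub>M (\<Pi>\<^sub>M i\<in>{2..K}. lborel))
    (\<lambda>\<omega>. (lam 1 \<omega>, param_differences K lam \<omega>)) (\<lambda>(x, s). ennreal (reparam_density K f x s))"
proof -
  have split: "{1..K} = insert 1 {2..K}"
    using K by auto
  define \<Phi> where "\<Phi> = (\<lambda>(x::real, t). \<lambda>i\<in>{1..K}. if i = 1 then x else t i + x)"
  define \<Psi> where "\<Psi> = (\<lambda>v::nat \<Rightarrow> real. (v 1, \<lambda>i\<in>{2..K}. v i - v 1))"
  have \<Phi>: "\<Phi> \<in> measurable (lborel \<Otimes>\<^sub>M (\<Pi>\<^sub>M i\<in>{2..K}. lborel)) (\<Pi>\<^sub>M i\<in>{1..K}. lborel)"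
    unfolding \<Phi>_def case_prod_beta
  proof (rule measurable_restrict)
    fix i assume "i \<in> {1..K}"
    then show "(\<lambda>z. if i = 1 then fst z else snd z i + fst z)
        \<in> measurable (lborel \<Otimes>\<^sub>M (\<Pi>\<^sub>M i\<in>{2..K}. lborel)) lborel"
      by (cases "i = 1") auto
  qed
  have \<Psi>: "\<Psi> \<in> measurable (\<Pi>\<^sub>M i\<in>{1..K}. lborel) (lborel \<Otimes>\<^sub>M (\<Pi>\<^sub>M i\<in>{2..K}. lborel))"
  proof -
    have comp: "(\<lambda>v. v i) \<in> borel_measurable (\<Pi>\<^sub>M i\<in>{1..K}. lborel :: real measure)"
      if "i \<in> {1..K}" for i
      using measurable_component_singleton[OF that, of "\<lambda>_. lborel :: real measure"] by simp
    have "(\<lambda>v. v 1) \<in> borel_measurable (\<Pi>\<^sub>M i\<in>{1..K}. lborel :: real measure)"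
      using K by (intro comp) auto
    moreover have "(\<lambda>v. v i - v 1) \<in> borel_measurable (\<Pi>\<^sub>M i\<in>{1..K}. lborel :: real measure)"
      if "i \<in> {2..K}" for i
      using that by (intro borel_measurable_diff comp) auto
    ultimately show ?thesis
      unfolding \<Psi>_def by (intro measurable_Pair measurable_restrict) auto
  qed
  have pres: "distr (lborel \<Otimes>\<^sub>M (\<Pi>\<^sub>M i\<in>{2..K}. lborel)) (\<Pi>\<^sub>M i\<in>{1..K}. lborel) \<Phi> = (\<Pi>\<^sub>M i\<in>{1..K}. lborel)"
    unfolding \<Phi>_def split by (rule distr_PiM_lborel_shear) auto
  have inv: "\<Psi> (\<Phi> z) = z" if "z \<in> space (lborel \<Otimes>\<^sub>M (\<Pi>\<^sub>M i\<in>{2..K}. lborel))" for z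
    using that K
    by (auto simp: \<Phi>_def \<Psi>_def space_pair_measure space_PiM PiE_iff extensional_def fun_eq_iff)
  have "(\<lambda>\<omega>. \<Psi> (param_vector K lam \<omega>)) = (\<lambda>\<omega>. (lam 1 \<omega>, param_differences K lam \<omega>))"
    using K by (auto simp: \<Psi>_def param_vector_def param_differences_def fun_eq_iff)
  moreover have "(\<lambda>z. ennreal (f (\<Phi> z))) = (\<lambda>(x, s). ennreal (reparam_density K f x s))"
    by (auto simp: \<Phi>_def reparam_density_def fun_eq_iff)
  ultimately show ?thesis
    using distributed_inverse_image[OF d \<Phi> pres \<Psi>] inv by simp
qed

section \<open>Inverse gamma densities\<close>

lemma borel_measurable_inverse_gamma_density [measurable]:
  "inverse_gamma_density a b \<in> borel_measurable borel"
  unfolding inverse_gamma_density_def by measurable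

lemma inverse_gamma_density_nonneg:
  "0 < a \<Longrightarrow> 0 \<le> inverse_gamma_density a b x"
  unfolding inverse_gamma_density_def by (auto simp: Gamma_real_nonneg)

lemma Gamma_integral_real_pos:
  assumes "0 < (a::real)"
  shows "((\<lambda>t. t powr (a - 1) * exp (- t)) has_integral Gamma a) {0<..}"
proof -
  have "((\<lambda>t. t powr (a - 1) / exp t) has_integral Gamma a) {0<..}"
    by (rule iffD1[OF has_integral_spike_set_eq Gamma_integral_real[OF assms]])
       (auto intro: negligible_subset[of "{0}"])
  then show ?thesis
    by (simp add: exp_minus field_simps)
qed

text \<open>
  The substitution \<open>x = 1 / (b * t)\<close> maps the half line to itself and turns the density into
  \<open>t powr (a - 1) * exp (- t) / Gamma a\<close>.
\<close>

lemma has_bochner_integral_inverse_gamma_density: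
  assumes a: "0 < a" and b: "0 < b"
  shows "has_bochner_integral lborel (inverse_gamma_density a b) 1"
proof -
  let ?f = "inverse_gamma_density a b" and ?g = "\<lambda>t::real. 1 / (b * t)"
  let ?g' = "\<lambda>t::real. - 1 / (b * t\<^sup>2)"
  have Gpos: "0 < Gamma a"
    using a by (rule Gamma_real_pos)
  have sub: "\<bar>?g' t\<bar> * ?f (?g t) = t powr (a - 1) * exp (- t) / Gamma a" if t: "0 < t" for t
  proof -
    have "?f (?g t) = 1 / (b powr a * Gamma a) * (b * t) powr (a + 1) * exp (- t)"
      using t b mult_pos_pos[OF b t, folded not_le]
      by (simp add: inverse_gamma_density_def powr_minus_divide powr_divide del: minus_add_distrib)
    also have "(b * t) powr (a + 1) = b powr a * b * (t powr (a - 1) * t\<^sup>2)"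
      using t b by (simp add: powr_mult powr_add powr_diff power2_eq_square)
    finally show ?thesis
      using t b by (simp add: field_simps)
  qed
  have "((\<lambda>t. \<bar>?g' t\<bar> * ?f (?g t)) has_integral (Gamma a / Gamma a)) {0<..}"
    using has_integral_divide[OF Gamma_integral_real_pos[OF a], of "Gamma a"]
    by (rule has_integral_eq[rotated]) (rule sub[symmetric], simp)
  then have int: "((\<lambda>t. \<bar>?g' t\<bar> * ?f (?g t)) has_integral 1) {0<..}"
    using Gpos by simp
  have img: "?g ` {0<..} = {0<..}"
  proof (intro set_eqI iffI)
    fix x :: real assume "x \<in> {0<..}"
    then show "x \<in> ?g ` {0<..}"
      using b by (intro image_eqI[where x = "1 / (b * x)"]) auto
  qed (use b in auto)
  have "?f absolutely_integrable_on (?g ` {0<..}) \<and> integral (?g ` {0<..}) ?f = 1"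
  proof (rule iffD1[OF has_absolute_integral_change_of_variables_1'])
    show "(\<lambda>x. \<bar>?g' x\<bar> * ?f (?g x)) absolutely_integrable_on {0<..} \<and>
        integral {0<..} (\<lambda>x. \<bar>?g' x\<bar> * ?f (?g x)) = 1"
      using int inverse_gamma_density_nonneg[OF a]
      by (auto intro!: nonnegative_absolutely_integrable_1 simp: has_integral_iff)
    show "(?g has_field_derivative ?g' x) (at x within {0<..})" if "x \<in> {0<..}" for x
      using that b by (auto intro!: derivative_eq_intros simp: field_simps power2_eq_square)
    show "inj_on ?g {0<..}"
      using b by (auto simp: inj_on_def)
  qed auto
  then have "(?f has_integral 1) {0<..}"
    unfolding img by (auto simp: has_integral_iff set_lebesgue_integral_eq_integral)
  then have "(?f has_integral 1) UNIV"
    by (rule has_integral_on_superset) (auto simp: inverse_gamma_density_def)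
  then have "(\<integral>\<^sup>+ x. ennreal (?f x) \<partial>lborel) = ennreal 1"
    by (intro nn_integral_has_integral_lborel) (auto simp: inverse_gamma_density_nonneg[OF a])
  then show ?thesis
    by (intro has_bochner_integral_nn_integral) (auto simp: inverse_gamma_density_nonneg[OF a])
qed

text \<open>
  In the product of the kernels \<open>x powr - (a i + 1) * exp (- 1 / (b i * x))\<close> the exponents and the
  rates add. Only positivity of the constant \<open>C\<close> is recorded, because its value cancels when the
  product is normalised.
\<close>

lemma prod_inverse_gamma_density:
  fixes a b :: "'i \<Rightarrow> real"
  assumes fin: "finite I" and ne: "I \<noteq> {}"
    and a: "\<And>i. i \<in> I \<Longrightarrow> 0 < a i" and b: "\<And>i. i \<in> I \<Longrightarrow> 0 < b i"
  defines "a' \<equiv> (\<Sum>i\<in>I. a i) + real (card I) - 1" and "b' \<equiv> inverse (\<Sum>i\<in>I. 1 / b i)"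
  shows "\<exists>C>0. \<forall>x. (\<Prod>i\<in>I. inverse_gamma_density (a i) (b i) x) = C * inverse_gamma_density a' b' x"
proof -
  define c where "c = (\<Prod>i\<in>I. 1 / (b i powr a i * Gamma (a i)))"
  have a': "0 < a'"
  proof -
    have "0 < (\<Sum>i\<in>I. a i)" using fin ne a by (rule sum_pos)
    moreover have "1 \<le> card I" using fin ne by (simp add: Suc_leI card_gt_0_iff)
    ultimately show ?thesis by (simp add: a'_def)
  qed
  have b': "0 < b'"
    unfolding b'_def using fin ne b by (simp add: sum_pos)
  have c: "0 < c"
    unfolding c_def by (rule prod_pos) (use a b in \<open>force intro!: divide_pos_pos mult_pos_pos Gamma_real_pos\<close>)
  \<comment> \<open>\<open>c\<close> collects the normalising constants of the factors; dividing by that of the target density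
    gives the constant of proportionality.\<close>
  have norm: "0 < b' powr a' * Gamma a'"
    using a' b' by (simp add: Gamma_real_pos)
  have "(\<Prod>i\<in>I. inverse_gamma_density (a i) (b i) x)
      = (c * (b' powr a' * Gamma a')) * inverse_gamma_density a' b' x" for x
  proof (cases "x \<le> 0")
    case True
    then show ?thesis
      using fin ne by (auto simp: inverse_gamma_density_def prod_zero_iff)
  next
    case x: False
    have "(\<Prod>i\<in>I. inverse_gamma_density (a i) (b i) x)
        = c * (\<Prod>i\<in>I. x powr (- (a i + 1))) * (\<Prod>i\<in>I. exp (- (1 / (b i * x))))"
      unfolding c_def prod.distrib[symmetric]
      using x by (intro prod.cong) (auto simp: inverse_gamma_density_def)
    also have "(\<Prod>i\<in>I. x powr (- (a i + 1))) = x powr (\<Sum>i\<in>I. - (a i + 1))"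
      using x fin by (intro powr_sum[symmetric]) auto
    also have "(\<Sum>i\<in>I. - (a i + 1)) = - (a' + 1)"
      by (simp add: a'_def sum_negf sum_subtractf sum.distrib)
    also have "(\<Prod>i\<in>I. exp (- (1 / (b i * x)))) = exp (\<Sum>i\<in>I. - (1 / (b i * x)))"
      using fin by (rule exp_sum[symmetric])
    also have "(\<Sum>i\<in>I. - (1 / (b i * x))) = - (1 / (b' * x))"
      by (simp add: b'_def sum_negf sum_divide_distrib divide_inverse sum_distrib_right)
    finally show ?thesis
      using x b' Gamma_real_pos[OF a'] by (simp add: inverse_gamma_density_def)
  qed
  then show ?thesis
    using mult_pos_pos[OF c norm] by blast
qed

section \<open>The coherent prior\<close>

theorem proposition2:
  fixes M :: "'w measure" and K :: nat and lam :: "nat \<Rightarrow> 'w \<Rightarrow> real" and a b :: "nat \<Rightarrow> real"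
  assumes "prob_space M"
    and "1 \<le> K"
    and "\<And>i. i \<in> {1..K} \<Longrightarrow> 0 < a i"
    and "\<And>i. i \<in> {1..K} \<Longrightarrow> 0 < b i"
    and "prob_space.indep_vars M (\<lambda>_. borel) lam {1..K}"
    and "\<And>i. i \<in> {1..K} \<Longrightarrow>
           distributed M lborel (lam i) (\<lambda>x. ennreal (inverse_gamma_density (a i) (b i) x))"
  shows "has_coherent_prior_density M K lam
           (product_density K (\<lambda>i. inverse_gamma_density (a i) (b i)))
           (inverse_gamma_density ((\<Sum>i = 1..K. a i) + real K - 1) (inverse (\<Sum>i = 1..K. 1 / b i)))"
proof -
  interpret prob_space M by fact
  let ?f = "product_density K (\<lambda>i. inverse_gamma_density (a i) (b i))"
  let ?a = "(\<Sum>i = 1..K. a i) + real K - 1" and ?b = "inverse (\<Sum>i = 1..K. 1 / b i)"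
  let ?p0 = "\<lambda>u. reparam_density K ?f u (\<lambda>i\<in>{2..K}. 0)"
  have ne: "{1..K} \<noteq> {}"
    using \<open>1 \<le> K\<close> by simp
  have "distributed M (\<Pi>\<^sub>M i\<in>{1..K}. lborel) (\<lambda>\<omega>. \<lambda>i\<in>{1..K}. lam i \<omega>)
      (\<lambda>v. \<Prod>i\<in>{1..K}. ennreal (inverse_gamma_density (a i) (b i) (v i)))"
    by (rule indep_vars_imp_distributed_PiM) (use assms ne in auto)
  moreover have "(\<Prod>i\<in>{1..K}. ennreal (inverse_gamma_density (a i) (b i) (v i))) = ennreal (?f v)" for v
    unfolding product_density_def using assms(3)
    by (intro prod_ennreal inverse_gamma_density_nonneg)
  ultimately have joint: "distributed M (\<Pi>\<^sub>M i\<in>{1..K}. lborel) (param_vector K lam) (\<lambda>v. ennreal (?f v))"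
    by (simp add: param_vector_def[abs_def])
  have "?p0 u = (\<Prod>i\<in>{1..K}. inverse_gamma_density (a i) (b i) u)" for u
    unfolding reparam_density_def product_density_def by (intro prod.cong) auto
  then obtain C where C: "0 < C" and p0: "\<And>u. ?p0 u = C * inverse_gamma_density ?a ?b u"
    using prod_inverse_gamma_density[of "{1..K}" a b] assms(3,4) ne by auto
  have a0: "0 < ?a"
    using sum_pos[of "{1..K}" a] assms(3) ne \<open>1 \<le> K\<close> by simp
  have b0: "0 < ?b"
    using sum_pos[of "{1..K}" "\<lambda>i. 1 / b i"] assms(4) ne by simp
  have int: "has_bochner_integral lborel ?p0 C"
    using has_bochner_integral_mult_right[OF has_bochner_integral_inverse_gamma_density[OF a0 b0], of C]
    by (simp add: p0[abs_def])
  then have "has_conditional_density M (lam 1) (\<Pi>\<^sub>M i\<in>{2..K}. lborel) (param_differences K lam)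
      (reparam_density K ?f) (\<lambda>i\<in>{2..K}. 0) (inverse_gamma_density ?a ?b)"
    unfolding has_conditional_density_def has_bochner_integral_integral_eq[OF int]
    using distributed_reparam[OF \<open>1 \<le> K\<close> joint] C p0
    by (auto simp: has_bochner_integral_iff)
  with joint show ?thesis
    by (simp add: has_coherent_prior_density_def)
qed

end
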